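(* Let $d\ge2$. Then $(h_{0,\beta})_1(0)\to0$ in probability as $\beta\to0$, where $(h_{0,\beta})_1(0)$ is the average of the random generalized function $h_{0,\beta}$ on $\mathbb R^d$ over the unit sphere $\partial B_1(0)$.
   Context: Kernel: $p_t$, $t>0$, is the convolution kernel of the solution operator at time $t$ of $\partial_tu+(-\Delta)^{d/2}u=0$ on $\mathbb R^d$, i.e. $\hat p_t(\zeta)=e^{-(2\pi)^dt|\zeta|^d}$, where $\hat f(\zeta)=\int e^{-2\pi ix\cdot\zeta}f(x)\,dx$. White noise fields: $W$ is a space-time white noise on $\mathbb R^d\times\mathbb R_+$, so $\int\!\!\int f\,dW$ is centered Gaussian with variance $\|f\|_{L^2}^2$. Let $c_d=2^{d-1}\pi^{d/2}\Gamma(d/2)$. For $\beta>0$, $h_{0,\beta}$ is the random generalized function $h_{0,\beta}(y)=\sqrt{c_d}\int_0^{\beta^2}\int_{\mathbb R^d}p_{t/2}(x-y)\,W(dx,dt)$. Its pairing with a finite measure $\nu$ (when defined) is $\sqrt{c_d}\int_0^{\beta^2}\int_{\mathbb R^d}\big(\int p_{t/2}(x-y)\,\nu(dy)\big)W(dx,dt)$; the unit-sphere average is the pairing with the uniform probability measure on $\partial B_1(0)$. *)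

theory Defs
  imports "HOL-Probability.Probability"
begin

definition fourier :: "(real^'n \<Rightarrow> real) \<Rightarrow> real^'n \<Rightarrow> complex" where
  "fourier f \<zeta> = (LINT x|lborel. exp (- 2 * pi * \<i> * complex_of_real (x \<bullet> \<zeta>)) * complex_of_real (f x))"

text \<open>
  The Fourier transform determines \<open>p t\<close> only up to null sets; continuity selects the version whose
  values on a sphere are meaningful, so \<open>p t\<close> is uniquely determined for \<open>t > 0\<close>.
  Nothing is said about \<open>p t\<close> for \<open>t \<le> 0\<close>.
\<close>

definition fractional_heat_kernel :: "(real \<Rightarrow> real^'n \<Rightarrow> real) \<Rightarrow> bool" where
  "fractional_heat_kernel p \<longleftrightarrow>
    (\<forall>t>0. continuous_on UNIV (p t) \<and> integrable lborel (p t) \<and>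
      (\<forall>\<zeta>. fourier (p t) \<zeta>
         = complex_of_real (exp (- ((2 * pi) ^ CARD('n)) * t * norm \<zeta> ^ CARD('n)))))"

definition c_const :: "nat \<Rightarrow> real" where
  "c_const d = 2 ^ (d - 1) * pi powr (real d / 2) * Gamma (real d / 2)"

definition spacetime :: "((real^'n) \<times> real) measure" where
  "spacetime = restrict_space lborel (UNIV \<times> {0..})"

definition L2 :: "'a measure \<Rightarrow> ('a \<Rightarrow> real) set" where
  "L2 N = {f \<in> borel_measurable N. integrable N (\<lambda>z. (f z)\<^sup>2)}"

text \<open>The case \<open>v = 0\<close> is separate because \<open>normal_density\<close> is a density only for positive
  standard deviation.\<close>

definition centered_gaussian :: "'w measure \<Rightarrow> ('w \<Rightarrow> real) \<Rightarrow> real \<Rightarrow> bool" where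
  "centered_gaussian M X v \<longleftrightarrow>
    X \<in> borel_measurable M \<and>
    (if v = 0 then AE \<omega> in M. X \<omega> = 0 else distributed M lborel X (normal_density 0 (sqrt v)))"

text \<open>
  \<open>W f\<close> is the stochastic integral of \<open>f\<close> against the noise. Almost sure linearity makes the family
  jointly Gaussian, with covariance the \<open>L2\<close> inner product by polarization; it also makes \<open>W f\<close>
  depend, almost surely, only on the class of \<open>f\<close> modulo null sets of \<open>spacetime\<close>.
  \<open>W f\<close> is arbitrary for \<open>f\<close> outside \<open>L2\<close>.
\<close>

definition white_noise :: "'w measure \<Rightarrow> (((real^'n) \<times> real \<Rightarrow> real) \<Rightarrow> 'w \<Rightarrow> real) \<Rightarrow> bool" where
  "white_noise M W \<longleftrightarrow>
    prob_space M \<and>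
    (\<forall>f\<in>L2 spacetime. centered_gaussian M (W f) (LINT z|spacetime. (f z)\<^sup>2)) \<and>
    (\<forall>f\<in>L2 spacetime. \<forall>g\<in>L2 spacetime. \<forall>a b.
       AE \<omega> in M. W (\<lambda>z. a * f z + b * g z) \<omega> = a * W f \<omega> + b * W g \<omega>)"

text \<open>
  The pairing of the field \<open>h\<^bsub>0,\<beta>\<^esub>\<close> with a finite measure \<open>\<nu>\<close>. The time slice \<open>t = 0\<close> is null and is
  left out because \<open>p 0\<close> is unspecified.
\<close>

definition h0_pairing ::
  "(((real^'n) \<times> real \<Rightarrow> real) \<Rightarrow> 'w \<Rightarrow> real) \<Rightarrow> (real \<Rightarrow> real^'n \<Rightarrow> real) \<Rightarrow> real \<Rightarrow> (real^'n) measure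
    \<Rightarrow> 'w \<Rightarrow> real" where
  "h0_pairing W p \<beta> \<nu> \<omega> =
    sqrt (c_const CARD('n)) *
    W (\<lambda>(x, t). indicator {0<..\<beta>\<^sup>2} t * (LINT y|\<nu>. p (t / 2) (x - y))) \<omega>"

text \<open>
  The uniform probability measure on the sphere of radius \<open>r\<close> about \<open>x\<close>, as normalized cone measure:
  the law of \<open>x + r u / |u|\<close> for \<open>u\<close> uniform in the unit ball.
\<close>

definition unif_sphere :: "real^'n \<Rightarrow> real \<Rightarrow> (real^'n) measure" where
  "unif_sphere x r = distr (uniform_measure lborel (ball 0 1)) borel (\<lambda>u. x + r *\<^sub>R sgn u)"

definition h0_sphere_avg ::
  "(((real^'n) \<times> real \<Rightarrow> real) \<Rightarrow> 'w \<Rightarrow> real) \<Rightarrow> (real \<Rightarrow> real^'n \<Rightarrow> real) \<Rightarrow> real \<Rightarrow> real \<Rightarrow> real^'n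
    \<Rightarrow> 'w \<Rightarrow> real" where
  "h0_sphere_avg W p \<beta> r x = h0_pairing W p \<beta> (unif_sphere x r)"

definition tendsto_in_prob :: "'w measure \<Rightarrow> ('i \<Rightarrow> 'w \<Rightarrow> real) \<Rightarrow> real \<Rightarrow> 'i filter \<Rightarrow> bool" where
  "tendsto_in_prob M X l F \<longleftrightarrow>
    (\<forall>\<^sub>F i in F. X i \<in> borel_measurable M) \<and>
    (\<forall>\<epsilon>>0. ((\<lambda>i. measure M {\<omega> \<in> space M. \<bar>X i \<omega> - l\<bar> > \<epsilon>}) \<longlongrightarrow> 0) F)"

lemma prob_space_unif_sphere: "prob_space (unif_sphere (x::real^'n) r)"
proof -
  have "prob_space (uniform_measure lborel (ball (0::real^'n) 1))"
    by (intro prob_space_uniform_measure)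
       (simp_all add: emeasure_ball less_imp_neq[OF unit_ball_vol_pos, symmetric])
  then show ?thesis
    unfolding unif_sphere_def by (rule prob_space.prob_space_distr) simp
qed

lemma AE_unif_sphere: "AE y in unif_sphere (x::real^'n) r. y \<in> sphere x \<bar>r\<bar>"
proof -
  have "AE u in lborel. u \<noteq> (0::real^'n)"
    by (rule AE_lborel_singleton)
  then have "AE u in uniform_measure lborel (ball (0::real^'n) 1). x + r *\<^sub>R sgn u \<in> sphere x \<bar>r\<bar>"
    by (intro AE_uniform_measureI) (simp, erule eventually_mono, simp add: dist_norm norm_sgn)
  then show ?thesis
    unfolding unif_sphere_def by (subst AE_distr_iff) simp_all
qed

end

theory Submission
  imports Defs
begin

text \<open>
  By Fourier inversion \<open>p s x = p 1 (s\<^bsup>-1/d\<^esup> x) / s\<close>, and \<open>p 1 z\<close> is bounded and \<open>O(1/|z|)\<close>, in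
  particular \<open>O(|z|\<^bsup>-1/2\<^esup>)\<close>. The singularity \<open>|x - y|\<^bsup>-1/2\<^esup>\<close> is integrable over the unit sphere uniformly
  in \<open>x\<close>: for a unit vector \<open>e\<close> orthogonal to \<open>x\<close> one has \<open>|x - u/|u|| \<ge> |u \<bullet> e|\<close> on the unit ball. Hence
  \<open>|p s| * \<sigma>\<close> is at most a constant times \<open>s\<^bsup>-1+1/(2d)\<^esup>\<close>, while its \<open>L\<^sup>1\<close> norm does not depend on \<open>s\<close>. So the
  squared \<open>L\<^sup>2\<close> norm of \<open>p (t/2) * \<sigma>\<close> is \<open>O(t\<^bsup>-1+1/(2d)\<^esup>)\<close>, the variance of the sphere average is
  \<open>O(\<beta>\<^bsup>1/d\<^esup>)\<close>, and Chebyshev's inequality concludes.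
\<close>

subsection \<open>Gaussians\<close>

lemma integral_lborel_affine:
  fixes f :: "'a::euclidean_space \<Rightarrow> 'b::{banach, second_countable_topology}"
  assumes [measurable]: "f \<in> borel_measurable borel" and "c \<noteq> 0"
  shows "(LINT x|lborel. f x) = \<bar>c\<bar> ^ DIM('a) *\<^sub>R (LINT x|lborel. f (t + c *\<^sub>R x))"
  by (subst lborel_affine[OF assms(2), of t]) (simp add: integral_density integral_distr)

lemma nn_integral_lborel_affine:
  fixes f :: "'a::euclidean_space \<Rightarrow> ennreal"
  assumes [measurable]: "f \<in> borel_measurable borel" and "c \<noteq> 0"
  shows "(\<integral>\<^sup>+x. f x \<partial>lborel) = ennreal (\<bar>c\<bar> ^ DIM('a)) * (\<integral>\<^sup>+x. f (t + c *\<^sub>R x) \<partial>lborel)"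
  by (subst lborel_affine[OF assms(2), of t])
     (simp add: nn_integral_density nn_integral_distr nn_integral_cmult)

lemma integrable_lborel_affine:
  fixes f :: "'a::euclidean_space \<Rightarrow> 'b::{banach, second_countable_topology}"
  assumes f: "integrable lborel f" and c: "c \<noteq> 0"
  shows "integrable lborel (\<lambda>x. f (t + c *\<^sub>R x))"
proof -
  have [measurable]: "f \<in> borel_measurable borel"
    using borel_measurable_integrable[OF f] by simp
  have "integrable (density (distr lborel borel (\<lambda>x. t + c *\<^sub>R x)) (\<lambda>_. \<bar>c\<bar> ^ DIM('a))) f"
    using f by (subst lborel_affine[OF c, of t, symmetric])
  then have "integrable lborel (\<lambda>x. \<bar>c\<bar> ^ DIM('a) *\<^sub>R f (t + c *\<^sub>R x))"
    by (subst (asm) integrable_density) (auto simp: integrable_distr_eq)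
  then have "integrable lborel (\<lambda>x. inverse (\<bar>c\<bar> ^ DIM('a)) *\<^sub>R \<bar>c\<bar> ^ DIM('a) *\<^sub>R f (t + c *\<^sub>R x))"
    by (rule integrable_scaleR_right)
  then show ?thesis using c by simp
qed

section \<open>The standard Gaussian and its Fourier transform\<close>

definition gauss :: "'a::euclidean_space \<Rightarrow> real" where
  "gauss v = exp (- (norm v)\<^sup>2 / 2)"

lemma gauss_measurable [measurable]: "gauss \<in> borel_measurable borel"
  unfolding gauss_def by measurable

lemma continuous_gauss: "continuous_on UNIV gauss"
  unfolding gauss_def by (intro continuous_intros) simp

lemma gauss_bounds [simp]: "0 < gauss v" "gauss v \<le> 1" "0 \<le> gauss v"
  by (auto simp: gauss_def)

lemma cis_measurable [measurable]: "cis \<in> borel_measurable borel"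
  by (intro borel_measurable_continuous_onI continuous_intros)

text \<open>This is the characteristic function of the standard normal law, freed of the
  normalization \<open>1 / sqrt (2 * pi)\<close>.\<close>

lemma char_gauss_real:
  "integrable lborel (\<lambda>x::real. cis (a * x) * exp (- x\<^sup>2 / 2))"
  "(LINT x|lborel. cis (a * x) * exp (- x\<^sup>2 / 2)) = complex_of_real (sqrt (2 * pi) * exp (- a\<^sup>2 / 2))"
proof -
  have i: "integrable lborel (\<lambda>x::real. std_normal_density x *\<^sub>R cis (a * x))"
    by (rule Bochner_Integration.integrable_bound[of _ std_normal_density])
       auto
  have eq: "cis (a * x) * exp (- x\<^sup>2 / 2) = sqrt (2 * pi) *\<^sub>R (std_normal_density x *\<^sub>R cis (a * x))" for x
    by (simp add: std_normal_density_def scaleR_conv_of_real)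
  show "integrable lborel (\<lambda>x::real. cis (a * x) * exp (- x\<^sup>2 / 2))"
    unfolding eq using i by (rule integrable_scaleR_right)
  have "(LINT x|lborel. std_normal_density x *\<^sub>R cis (a * x)) = char std_normal_distribution a"
    unfolding char_def cis_conv_exp by (subst integral_density) (auto simp: ac_simps)
  also have "\<dots> = complex_of_real (exp (- a\<^sup>2 / 2))"
    by (simp add: char_std_normal_distribution)
  finally show "(LINT x|lborel. cis (a * x) * exp (- x\<^sup>2 / 2)) = complex_of_real (sqrt (2 * pi) * exp (- a\<^sup>2 / 2))"
    unfolding eq by (simp add: scaleR_conv_of_real)
qed

text \<open>Lebesgue measure is the image of a product of one-dimensional Lebesgue measures under
  assembling coordinates, so such integrals separate.\<close>

lemma lborel_integral_prod:
  fixes f :: "'a::euclidean_space \<Rightarrow> real \<Rightarrow> 'b::{real_normed_field, banach, second_countable_topology}"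
  assumes f: "\<And>b. b \<in> Basis \<Longrightarrow> integrable lborel (f b)"
  shows "integrable lborel (\<lambda>x. \<Prod>b\<in>Basis. f b (x \<bullet> b))"
    and "(LINT x|lborel. (\<Prod>b\<in>Basis. f b (x \<bullet> b))) = (\<Prod>b\<in>Basis. LINT x|lborel. f b x)"
proof -
  have [measurable]: "f b \<in> borel_measurable borel" if "b \<in> Basis" for b
    using borel_measurable_integrable[OF f[OF that]] by simp
  interpret product_sigma_finite "\<lambda>b::'a. lborel :: real measure"
    by standard
  have eq: "(\<Prod>b\<in>Basis. f b ((\<Sum>a\<in>Basis. x a *\<^sub>R a) \<bullet> b)) = (\<Prod>b\<in>Basis. f b (x b))" for x
    by (intro prod.cong) simp_all
  show "integrable lborel (\<lambda>x. \<Prod>b\<in>Basis. f b (x \<bullet> b))"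
    by (subst lborel_eq, subst integrable_distr_eq) (auto simp: eq intro!: product_integrable_prod f)
  show "(LINT x|lborel. (\<Prod>b\<in>Basis. f b (x \<bullet> b))) = (\<Prod>b\<in>Basis. LINT x|lborel. f b x)"
    by (subst lborel_eq, subst integral_distr) (auto simp: eq intro!: product_integral_prod f)
qed

lemma exp_norm_prod:
  fixes v :: "'a::euclidean_space"
  shows "exp (- (norm v)\<^sup>2 / 2) = (\<Prod>b\<in>Basis. exp (- (v \<bullet> b)\<^sup>2 / 2))"
proof -
  have "(norm v)\<^sup>2 = (\<Sum>b\<in>Basis. (v \<bullet> b)\<^sup>2)"
    unfolding power2_norm_eq_inner by (subst euclidean_inner) (simp add: power2_eq_square)
  then show ?thesis
    by (simp add: exp_sum[symmetric] sum_negf sum_divide_distrib)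
qed

text \<open>Both the character and the Gaussian factor over coordinates, which reduces the claim to
  the one-dimensional formula.\<close>

lemma char_gauss:
  fixes w :: "'a::euclidean_space"
  shows "integrable lborel (\<lambda>v. cis (w \<bullet> v) * gauss v)"
    and "(LINT v|lborel. cis (w \<bullet> v) * gauss v) = complex_of_real (sqrt (2 * pi) ^ DIM('a) * gauss w)"
proof -
  have cis_sum: "cis (\<Sum>b\<in>A. g b) = (\<Prod>b\<in>A. cis (g b))" for A and g :: "'a \<Rightarrow> real"
    by (induction A rule: infinite_finite_induct) (simp_all flip: cis_mult)
  have eq: "cis (w \<bullet> v) * gauss v = (\<Prod>b\<in>Basis. cis ((w \<bullet> b) * (v \<bullet> b)) * exp (- (v \<bullet> b)\<^sup>2 / 2))" for v
    unfolding gauss_def exp_norm_prod prod.distrib of_real_prod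
    by (subst euclidean_inner) (simp add: cis_sum)
  show "integrable lborel (\<lambda>v. cis (w \<bullet> v) * gauss v)"
    unfolding eq by (intro lborel_integral_prod char_gauss_real)
  show "(LINT v|lborel. cis (w \<bullet> v) * gauss v) = complex_of_real (sqrt (2 * pi) ^ DIM('a) * gauss w)"
    unfolding eq
    by (subst lborel_integral_prod(2), rule char_gauss_real)
       (simp only: char_gauss_real(2) gauss_def exp_norm_prod of_real_mult of_real_prod prod.distrib
         prod_constant of_real_power)
qed

lemma integrable_gauss: "integrable lborel (gauss :: 'a::euclidean_space \<Rightarrow> real)"
  using integrable_norm[OF char_gauss(1)[of "0::'a"]] by (simp add: norm_mult)

lemma integral_gauss: "(LINT v|lborel. gauss (v::'a::euclidean_space)) = sqrt (2 * pi) ^ DIM('a)"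
proof -
  have "complex_of_real (LINT v|lborel. gauss (v::'a)) = complex_of_real (sqrt (2 * pi) ^ DIM('a))"
    using char_gauss(2)[of "0::'a"] by (simp add: gauss_def)
  then show ?thesis by (simp only: of_real_eq_iff)
qed

subsection \<open>Fourier inversion\<close>

text \<open>As \<open>f\<close> may be unbounded, dominated convergence works only where the
  argument of \<open>f\<close> stays in the compact ball \<open>S\<close>. Outside \<open>S\<close>
  one has \<open>norm v > K n\<close>; there the Gaussian is at most
  \<open>exp (- (K n)\<^sup>2 / 2)\<close>, which beats the factor \<open>K n ^ DIM('a)\<close> that
  rescaling to the \<open>L1\<close> norm of \<open>f\<close> costs.\<close>

lemma gauss_approximate_identity:
  fixes f :: "'a::euclidean_space \<Rightarrow> real"
  assumes cont: "continuous_on UNIV f" and int: "integrable lborel f"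
    and K: "filterlim K at_top sequentially" "\<And>n. K n > 0"
  shows "(\<lambda>n. LINT v|lborel. f (x + (1 / K n) *\<^sub>R v) * gauss v) \<longlonglongrightarrow> f x * (LINT v|lborel. gauss (v::'a))"
proof -
  have [measurable]: "f \<in> borel_measurable borel"
    using cont by (rule borel_measurable_continuous_onI)
  define S where "S = cball x 1"
  have [measurable]: "S \<in> sets borel" by (simp add: S_def)
  have "compact (f ` S)"
    unfolding S_def by (intro compact_continuous_image continuous_on_subset[OF cont]) auto
  then obtain B where B: "\<And>y. y \<in> S \<Longrightarrow> \<bar>f y\<bar> \<le> B"
    using compact_imp_bounded by (fastforce simp: bounded_iff)
  have "B \<ge> 0" using B[of x] by (auto simp: S_def)
  let ?y = "\<lambda>n v. x + (1 / K n) *\<^sub>R v"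
  let ?near = "\<lambda>n v. indicator S (?y n v) * f (?y n v) * gauss v"
  let ?far = "\<lambda>n v. indicator (- S) (?y n v) * f (?y n v) * gauss v"
  have K0: "(\<lambda>n. 1 / K n) \<longlonglongrightarrow> 0"
    using K(1) by (rule real_tendsto_divide_at_top[OF tendsto_const])
  have y: "(\<lambda>n. ?y n v) \<longlonglongrightarrow> x" for v
    by (rule tendsto_eq_intros K0 refl | simp)+
  have near_bd: "norm (?near n v) \<le> B * gauss v" for n v
    using B[of "?y n v"] \<open>B \<ge> 0\<close> by (auto simp: indicator_def abs_mult intro!: mult_right_mono)
  have ig: "integrable lborel (\<lambda>v::'a. B * gauss v)"
    by (intro integrable_mult_right integrable_gauss)
  have near_int: "integrable lborel (?near n)" for n
    by (rule Bochner_Integration.integrable_bound[OF ig]) (use near_bd \<open>B \<ge> 0\<close> in \<open>auto simp: abs_of_nonneg\<close>)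
  have near: "(\<lambda>n. LINT v|lborel. ?near n v) \<longlonglongrightarrow> (LINT v|lborel. f x * gauss (v::'a))"
  proof (rule integral_dominated_convergence[OF _ _ ig])
    show "AE v in lborel. (\<lambda>n. ?near n v) \<longlonglongrightarrow> f x * gauss v"
    proof (intro AE_I2)
      fix v :: 'a
      have "eventually (\<lambda>n. ?y n v \<in> ball x 1) sequentially"
        using y by (rule topological_tendstoD) auto
      then have "eventually (\<lambda>n. f (?y n v) * gauss v = ?near n v) sequentially"
        by eventually_elim (auto simp: S_def)
      moreover have "(\<lambda>n. f (?y n v) * gauss v) \<longlonglongrightarrow> f x * gauss v"
        by (intro tendsto_mult_right continuous_on_tendsto_compose[OF cont y]) auto
      ultimately show "(\<lambda>n. ?near n v) \<longlonglongrightarrow> f x * gauss v"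
        by (rule Lim_transform_eventually[rotated])
    qed
  qed (use near_bd in auto)
  have shift_int: "integrable lborel (\<lambda>v. f (?y n v))" for n
    using K(2)[of n] by (intro integrable_lborel_affine int) auto
  have far_bd: "norm (?far n v) \<le> exp (- (K n)\<^sup>2 / 2) * \<bar>f (?y n v)\<bar>" for n v
  proof (cases "?y n v \<in> S")
    case False
    then have "1 < norm v / K n"
      using K(2)[of n] by (simp add: S_def dist_norm)
    then have "K n \<le> norm v"
      using K(2)[of n] by (simp add: field_simps)
    then have "(K n)\<^sup>2 \<le> (norm v)\<^sup>2"
      using K(2)[of n] by (intro power_mono) auto
    then have "gauss v \<le> exp (- (K n)\<^sup>2 / 2)"
      by (simp add: gauss_def)
    then have "gauss v * \<bar>f (?y n v)\<bar> \<le> exp (- (K n)\<^sup>2 / 2) * \<bar>f (?y n v)\<bar>"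
      by (rule mult_right_mono) simp
    then show ?thesis
      using False by (simp add: abs_mult mult.commute)
  qed simp
  have far_int: "integrable lborel (?far n)" for n
    by (rule Bochner_Integration.integrable_bound[OF integrable_mult_right[OF integrable_abs[OF shift_int[of n]],
          of "exp (- (K n)\<^sup>2 / 2)"]])
       (use far_bd[of n] in auto)
  have far_est: "norm (LINT v|lborel. ?far n v) \<le> (K n ^ DIM('a) / exp ((K n)\<^sup>2 / 2)) * (LINT y|lborel. \<bar>f y\<bar>)" for n
  proof -
    have "norm (LINT v|lborel. ?far n v) \<le> (LINT v|lborel. exp (- (K n)\<^sup>2 / 2) * \<bar>f (?y n v)\<bar>)"
      using far_bd by (intro Bochner_Integration.integral_norm_bound_integral far_int integrable_mult_right integrable_abs shift_int) auto
    also have "\<dots> = exp (- (K n)\<^sup>2 / 2) * (K n ^ DIM('a) * (LINT y|lborel. \<bar>f y\<bar>))"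
      using K(2)[of n] by (subst (2) integral_lborel_affine[of _ "1 / K n" x]) (auto simp: field_simps)
    finally show ?thesis by (simp add: exp_minus field_simps)
  qed
  have "(\<lambda>n. K n ^ DIM('a) / exp (K n)) \<longlonglongrightarrow> 0"
    using K(1) by (rule filterlim_compose[OF tendsto_power_div_exp_0])
  \<comment> \<open>Once \<open>K n > 2\<close>, the exponent \<open>(K n)\<^sup>2 / 2\<close>
    exceeds \<open>K n\<close>, so the plain exponential comparison applies.\<close>
  moreover have "\<forall>\<^sub>F n in sequentially. norm (K n ^ DIM('a) / exp ((K n)\<^sup>2 / 2)) \<le> K n ^ DIM('a) / exp (K n)"
    using filterlim_at_top_dense[THEN iffD1, OF K(1), rule_format, of 2]
  proof eventually_elim
    case (elim n)
    then have "exp (K n) \<le> exp ((K n)\<^sup>2 / 2)"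
      by (simp add: power2_eq_square)
    then show ?case using elim by (simp add: divide_left_mono)
  qed
  ultimately have "(\<lambda>n. K n ^ DIM('a) / exp ((K n)\<^sup>2 / 2)) \<longlonglongrightarrow> 0"
    by (rule Lim_null_comparison[rotated])
  then have "(\<lambda>n. (K n ^ DIM('a) / exp ((K n)\<^sup>2 / 2)) * (LINT y|lborel. \<bar>f y\<bar>)) \<longlonglongrightarrow> 0"
    by (rule tendsto_mult_left_zero)
  then have far: "(\<lambda>n. LINT v|lborel. ?far n v) \<longlonglongrightarrow> 0"
    by (rule Lim_null_comparison[rotated]) (use far_est in auto)
  have "(LINT v|lborel. f (?y n v) * gauss v) = (LINT v|lborel. ?near n v) + (LINT v|lborel. ?far n v)" for n
    by (subst Bochner_Integration.integral_add[OF near_int far_int, symmetric])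
       (auto intro!: Bochner_Integration.integral_cong simp: indicator_def)
  then show ?thesis using tendsto_add[OF near far] by simp
qed

text \<open>The inversion integral is damped by a wide Gaussian. Fubini turns the damped integral
  into an average of \<open>f\<close> around \<open>x\<close> against a Gaussian of width
  \<open>1 / (2 * pi * k)\<close>. As \<open>k\<close> grows, dominated convergence removes the
  damping on one side, and the approximate identity produces \<open>f x\<close> on the
  other.\<close>

theorem fourier_inversion:
  fixes f :: "real^'n \<Rightarrow> real"
  assumes cont: "continuous_on UNIV f" and int: "integrable lborel f"
    and F: "integrable lborel (fourier f)"
  shows "complex_of_real (f x) = (LINT \<zeta>|lborel. cis (2 * pi * (x \<bullet> \<zeta>)) * fourier f \<zeta>)"
proof -
  define Z where "Z = sqrt (2 * pi) ^ CARD('n)"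
  \<comment> \<open>One factor \<open>Z\<close> comes from transforming the damping Gaussian, the
    other is the mass of \<open>gauss\<close> in the limit; together they cancel
    \<open>(2 * pi) ^ CARD('n)\<close>.\<close>
  have Z: "(LINT v|lborel. gauss (v::real^'n)) = Z" "Z * Z = (2 * pi) ^ CARD('n)"
    by (simp add: integral_gauss Z_def, simp only: Z_def power_mult_distrib[symmetric], simp)
  have [measurable]: "f \<in> borel_measurable borel"
    using cont by (rule borel_measurable_continuous_onI)
  have [measurable]: "fourier f \<in> borel_measurable borel"
    using borel_measurable_integrable[OF F] by simp
  have fourier_cis: "fourier f \<zeta> = (LINT y|lborel. cis (- 2 * pi * (y \<bullet> \<zeta>)) * f y)" for \<zeta>
    unfolding fourier_def cis_conv_exp by (simp add: ac_simps)
  have kernel: "(LINT \<zeta>|lborel. cis (2 * pi * ((x - y) \<bullet> \<zeta>)) * gauss ((1 / k) *\<^sub>R \<zeta>))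
      = of_real (k ^ CARD('n) * Z * gauss ((2 * pi * k) *\<^sub>R (x - y)))" if "k > 0" for k y
  proof -
    have "(LINT \<zeta>|lborel. cis (2 * pi * ((x - y) \<bullet> \<zeta>)) * gauss ((1 / k) *\<^sub>R \<zeta>))
        = k ^ CARD('n) *\<^sub>R (LINT \<zeta>|lborel. cis (((2 * pi * k) *\<^sub>R (x - y)) \<bullet> \<zeta>) * gauss \<zeta>)"
      using that by (subst integral_lborel_affine[of _ k 0]) (auto simp: ac_simps)
    also have "\<dots> = of_real (k ^ CARD('n) * Z * gauss ((2 * pi * k) *\<^sub>R (x - y)))"
      by (subst char_gauss(2)) (simp add: Z_def scaleR_conv_of_real)
    finally show ?thesis .
  qed
  have regularized: "(LINT \<zeta>|lborel. cis (2 * pi * (x \<bullet> \<zeta>)) * fourier f \<zeta> * gauss ((1 / k) *\<^sub>R \<zeta>))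
      = of_real (Z / (2 * pi) ^ CARD('n) * (LINT v|lborel. f (x + (1 / (2 * pi * k)) *\<^sub>R v) * gauss v))"
    (is "?I = _") if k: "k > 0" for k
  proof -
    define G where "G y \<zeta> = cis (2 * pi * ((x - y) \<bullet> \<zeta>)) * gauss ((1 / k) *\<^sub>R \<zeta>) * f y" for y \<zeta>
    have ik: "integrable lborel (\<lambda>\<zeta>::real^'n. gauss ((1 / k) *\<^sub>R \<zeta>))"
      using integrable_lborel_affine[OF integrable_gauss, of "1 / k" "0::real^'n"] k by simp
    have [measurable]: "case_prod G \<in> borel_measurable (lborel \<Otimes>\<^sub>M lborel)"
      unfolding G_def by measurable
    have "integrable (lborel \<Otimes>\<^sub>M lborel) (case_prod G)"
    proof (rule lborel_pair.Fubini_integrable)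
      show "integrable lborel (\<lambda>y. LINT \<zeta>|lborel. norm (case (y, \<zeta>) of (y, \<zeta>) \<Rightarrow> G y \<zeta>))"
        using int by (simp add: G_def norm_mult)
      show "AE y in lborel. integrable lborel (\<lambda>\<zeta>. case (y, \<zeta>) of (y, \<zeta>) \<Rightarrow> G y \<zeta>)"
      proof (intro AE_I2)
        fix y
        show "integrable lborel (\<lambda>\<zeta>. case (y, \<zeta>) of (y, \<zeta>) \<Rightarrow> G y \<zeta>)"
          by (rule Bochner_Integration.integrable_bound[OF integrable_mult_left[OF ik, of "f y"]])
             (auto simp: G_def norm_mult abs_mult)
      qed
    qed simp
    then have "(LINT \<zeta>|lborel. LINT y|lborel. G y \<zeta>) = (LINT y|lborel. LINT \<zeta>|lborel. G y \<zeta>)"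
      by (rule lborel_pair.Fubini_integral)
    moreover have "?I = (LINT \<zeta>|lborel. LINT y|lborel. G y \<zeta>)"
    proof (rule Bochner_Integration.integral_cong[OF refl])
      fix \<zeta>
      have "G y \<zeta> = (cis (2 * pi * (x \<bullet> \<zeta>)) * gauss ((1 / k) *\<^sub>R \<zeta>)) * (cis (- 2 * pi * (y \<bullet> \<zeta>)) * f y)" for y
      proof -
        have "cis (2 * pi * ((x - y) \<bullet> \<zeta>)) = cis (2 * pi * (x \<bullet> \<zeta>)) * cis (- 2 * pi * (y \<bullet> \<zeta>))"
          unfolding cis_mult by (simp add: inner_diff_left right_diff_distrib)
        then show ?thesis by (simp add: G_def)
      qed
      then show "cis (2 * pi * (x \<bullet> \<zeta>)) * fourier f \<zeta> * gauss ((1 / k) *\<^sub>R \<zeta>) = (LINT y|lborel. G y \<zeta>)"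
        by (simp add: fourier_cis)
    qed
    moreover have "(LINT y|lborel. LINT \<zeta>|lborel. G y \<zeta>)
        = of_real (LINT y|lborel. k ^ CARD('n) * Z * gauss ((2 * pi * k) *\<^sub>R (x - y)) * f y)"
      using k by (simp add: G_def kernel flip: of_real_mult)
    \<comment> \<open>The substitution \<open>y = x + v / (2 * pi * k)\<close> absorbs
      \<open>k ^ CARD('n)\<close> and leaves the inverse power of \<open>2 * pi\<close>.\<close>
    moreover have "(LINT y|lborel. k ^ CARD('n) * Z * gauss ((2 * pi * k) *\<^sub>R (x - y)) * f y)
        = Z / (2 * pi) ^ CARD('n) * (LINT v|lborel. f (x + (1 / (2 * pi * k)) *\<^sub>R v) * gauss v)"
      using k by (subst integral_lborel_affine[of _ "1 / (2 * pi * k)" x])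
        (auto simp: gauss_def power_mult_distrib field_simps)
    ultimately show ?thesis by simp
  qed
  define K where "K n = real (Suc n)" for n
  have K: "filterlim K at_top sequentially" "\<And>n. K n > 0"
    unfolding K_def by (rule filterlim_compose[OF filterlim_real_sequentially filterlim_Suc]) simp
  have "(\<lambda>n. LINT \<zeta>|lborel. cis (2 * pi * (x \<bullet> \<zeta>)) * fourier f \<zeta> * gauss ((1 / K n) *\<^sub>R \<zeta>))
      \<longlonglongrightarrow> (LINT \<zeta>|lborel. cis (2 * pi * (x \<bullet> \<zeta>)) * fourier f \<zeta>)"
  proof (rule integral_dominated_convergence[where w="\<lambda>\<zeta>. norm (fourier f \<zeta>)"])
    have K0: "(\<lambda>n. 1 / K n) \<longlonglongrightarrow> 0"
      using K(1) by (rule real_tendsto_divide_at_top[OF tendsto_const])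
    have "(\<lambda>n. gauss ((1 / K n) *\<^sub>R \<zeta>)) \<longlonglongrightarrow> gauss (0 *\<^sub>R \<zeta>)" for \<zeta> :: "real^'n"
      by (intro continuous_on_tendsto_compose[OF continuous_gauss] tendsto_intros K0) auto
    then have g: "(\<lambda>n. gauss ((1 / K n) *\<^sub>R \<zeta>)) \<longlonglongrightarrow> 1" for \<zeta> :: "real^'n"
      by (simp add: gauss_def)
    show "AE \<zeta> in lborel. (\<lambda>n. cis (2 * pi * (x \<bullet> \<zeta>)) * fourier f \<zeta> * gauss ((1 / K n) *\<^sub>R \<zeta>))
        \<longlonglongrightarrow> cis (2 * pi * (x \<bullet> \<zeta>)) * fourier f \<zeta>"
    proof (intro AE_I2)
      fix \<zeta> :: "real^'n"
      show "(\<lambda>n. cis (2 * pi * (x \<bullet> \<zeta>)) * fourier f \<zeta> * gauss ((1 / K n) *\<^sub>R \<zeta>))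
        \<longlonglongrightarrow> cis (2 * pi * (x \<bullet> \<zeta>)) * fourier f \<zeta>"
        using tendsto_mult_left[OF tendsto_of_real[OF g], of "cis (2 * pi * (x \<bullet> \<zeta>)) * fourier f \<zeta>" \<zeta>] by simp
    qed
    show "integrable lborel (\<lambda>\<zeta>. norm (fourier f \<zeta>))" using F by simp
  qed (auto simp: norm_mult mult_left_le)
  moreover have "(\<lambda>n. complex_of_real (Z / (2 * pi) ^ CARD('n) * (LINT v|lborel. f (x + (1 / (2 * pi * K n)) *\<^sub>R v) * gauss v)))
      \<longlonglongrightarrow> of_real (Z / (2 * pi) ^ CARD('n) * (f x * Z))"
    unfolding Z(1)[symmetric]
    by (intro tendsto_of_real tendsto_mult_left gauss_approximate_identity cont int
          filterlim_tendsto_pos_mult_at_top[OF tendsto_const] K(1)) (auto simp: K(2))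
  ultimately have "(LINT \<zeta>|lborel. cis (2 * pi * (x \<bullet> \<zeta>)) * fourier f \<zeta>) = of_real (Z / (2 * pi) ^ CARD('n) * (f x * Z))"
    unfolding regularized[OF K(2)] by (rule LIMSEQ_unique)
  also have "Z / (2 * pi) ^ CARD('n) * (f x * Z) = f x"
    using Z(2) by (simp add: field_simps)
  finally show ?thesis ..
qed

subsection \<open>The kernel at time one\<close>

lemma exp_power_le:
  fixes r c :: real
  assumes "0 \<le> r" "2 \<le> d" "1 \<le> c"
  shows "exp (- c * r ^ d) \<le> exp 1 * exp (- r\<^sup>2)"
proof (cases "r \<le> 1")
  case True
  have "r\<^sup>2 \<le> 1" using True assms by (simp add: power_le_one)
  moreover have "0 \<le> c * r ^ d" using assms by simp
  ultimately show ?thesis unfolding exp_add[symmetric] by simp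
next
  case False
  have "1 * r\<^sup>2 \<le> c * r ^ d"
    using False assms by (intro mult_mono power_increasing) auto
  then show ?thesis unfolding exp_add[symmetric] by simp
qed

text \<open>For \<open>r > 1\<close> the factor \<open>exp (r ^ d)\<close> absorbs
  \<open>r ^ (d - 1)\<close>. This lowers the rate from \<open>c\<close> to \<open>c - 1\<close>,
  still at least 1 as the previous bound requires; hence \<open>2 \<le> c\<close>.\<close>

lemma exp_power_deriv_le:
  fixes r c :: real
  assumes r: "0 \<le> r" and d: "2 \<le> d" and c: "2 \<le> c"
  shows "r ^ (d - 1) * exp (- c * r ^ d) \<le> exp 1 * exp (- r\<^sup>2)"
proof (cases "r \<le> 1")
  case True
  have "r ^ (d - 1) * exp (- c * r ^ d) \<le> 1 * exp (- c * r ^ d)"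
    using True assms by (intro mult_right_mono power_le_one) auto
  also have "\<dots> \<le> exp 1 * exp (- r\<^sup>2)"
    using exp_power_le[of r d c] assms by simp
  finally show ?thesis .
next
  case False
  have "r ^ (d - 1) \<le> r ^ d" using False by (intro power_increasing) auto
  also have "\<dots> \<le> exp (r ^ d)" using exp_ge_add_one_self[of "r ^ d"] by linarith
  finally have "r ^ (d - 1) * exp (- c * r ^ d) \<le> exp (r ^ d) * exp (- c * r ^ d)"
    by (rule mult_right_mono) simp
  also have "\<dots> = exp (- (c - 1) * r ^ d)"
    by (simp add: algebra_simps flip: exp_add)
  also have "\<dots> \<le> exp 1 * exp (- r\<^sup>2)"
    using assms by (intro exp_power_le) auto
  finally show ?thesis .
qed

text \<open>By the mean value theorem the increment is a derivative at an intermediate point. Its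
  Gaussian bound decreases in the radius, so it may be evaluated at the smaller endpoint.\<close>

lemma exp_power_lipschitz:
  fixes r s c :: real
  assumes r: "0 \<le> r" and s: "0 \<le> s" and d: "2 \<le> d" and c: "2 \<le> c"
  shows "\<bar>exp (- c * r ^ d) - exp (- c * s ^ d)\<bar> \<le> c * d * exp 1 * \<bar>r - s\<bar> * exp (- (min r s)\<^sup>2)"
proof -
  have main: "\<bar>exp (- c * r ^ d) - exp (- c * s ^ d)\<bar> \<le> c * d * exp 1 * \<bar>r - s\<bar> * exp (- r\<^sup>2)"
    if r: "0 \<le> r" and rs: "r < s" for r s
  proof -
    have "((\<lambda>x. exp (- c * x ^ d)) has_real_derivative - c * (d * x ^ (d - 1)) * exp (- c * x ^ d)) (at x)" for x :: real
      by (auto intro!: derivative_eq_intros)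
    then obtain z :: real where z: "r < z" "z < s"
      "exp (- c * s ^ d) - exp (- c * r ^ d) = (s - r) * (- c * (d * z ^ (d - 1)) * exp (- c * z ^ d))"
      using MVT2[OF rs, of "\<lambda>x. exp (- c * x ^ d)" "\<lambda>x. - c * (d * x ^ (d - 1)) * exp (- c * x ^ d)"]
      by auto
    have "\<bar>exp (- c * r ^ d) - exp (- c * s ^ d)\<bar> = \<bar>r - s\<bar> * (c * d) * (z ^ (d - 1) * exp (- c * z ^ d))"
      using z r c rs by (simp add: abs_minus_commute[of "exp _"] abs_mult)
    also have "\<dots> \<le> \<bar>r - s\<bar> * (c * d) * (exp 1 * exp (- z\<^sup>2))"
      using r z d c by (intro mult_left_mono exp_power_deriv_le) auto
    also have "\<dots> \<le> \<bar>r - s\<bar> * (c * d) * (exp 1 * exp (- r\<^sup>2))"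
      using r z c by (intro mult_left_mono) (auto intro: power_mono)
    finally show ?thesis by (simp add: ac_simps)
  qed
  show ?thesis
  proof (cases r s rule: linorder_cases)
    case less then show ?thesis using main[OF r] by simp
  next
    case greater then show ?thesis using main[OF s] by (simp add: abs_minus_commute)
  qed simp
qed

section \<open>The Fourier symbol of the kernel at time one\<close>

text \<open>This is the Fourier transform of \<open>p 1\<close>; other times are reached by dilating
  the argument.\<close>

definition heat_symbol :: "real^'n \<Rightarrow> real" where
  "heat_symbol \<zeta> = exp (- ((2 * pi) ^ CARD('n)) * norm \<zeta> ^ CARD('n))"

lemma two_pi_power_ge: "2 \<le> d \<Longrightarrow> 2 \<le> (2 * pi) ^ d"
proof -
  assume "2 \<le> d"
  have "2 \<le> (2 * pi) ^ 1" using pi_gt3 by simp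
  also have "\<dots> \<le> (2 * pi) ^ d" using pi_gt3 \<open>2 \<le> d\<close> by (intro power_increasing) auto
  finally show ?thesis .
qed

lemma heat_symbol_measurable [measurable]: "heat_symbol \<in> borel_measurable borel"
  unfolding heat_symbol_def by measurable

lemma heat_symbol_pos [simp]: "0 < heat_symbol \<zeta>" "0 \<le> heat_symbol \<zeta>"
  by (auto simp: heat_symbol_def)

lemma integrable_heat_symbol:
  assumes "CARD('n) \<ge> 2"
  shows "integrable lborel (heat_symbol :: real^'n \<Rightarrow> real)"
proof (rule Bochner_Integration.integrable_bound)
  show "integrable lborel (\<lambda>\<zeta>::real^'n. exp 1 * gauss \<zeta>)"
    by (intro integrable_mult_right integrable_gauss)
  have "heat_symbol \<zeta> \<le> exp 1 * gauss \<zeta>" for \<zeta> :: "real^'n"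
  proof -
    have "heat_symbol \<zeta> \<le> exp 1 * exp (- (norm \<zeta>)\<^sup>2)"
      unfolding heat_symbol_def using assms two_pi_power_ge[OF assms] by (intro exp_power_le) auto
    also have "\<dots> \<le> exp 1 * gauss \<zeta>" by (simp add: gauss_def)
    finally show ?thesis .
  qed
  then show "AE \<zeta> in lborel. norm (heat_symbol \<zeta>) \<le> norm (exp 1 * gauss (\<zeta>::real^'n))"
    by (simp add: abs_of_nonneg)
qed simp

text \<open>Radially this is the preceding increment bound. A shift of length at most
  \<open>1 / 2\<close> moves the norm by at most \<open>1 / 2\<close>, and the gap between
  \<open>exp (- r\<^sup>2)\<close> and \<open>gauss\<close> pays for that with one more factor
  \<open>exp 1\<close>. The majorant thus depends on the unshifted frequency only and is
  integrable.\<close>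

lemma heat_symbol_lipschitz:
  fixes \<zeta> h :: "real^'n"
  assumes d: "CARD('n) \<ge> 2" and h: "norm h \<le> 1 / 2"
  shows "\<bar>heat_symbol \<zeta> - heat_symbol (h + \<zeta>)\<bar> \<le> (2 * pi) ^ CARD('n) * CARD('n) * exp 2 * norm h * gauss \<zeta>"
proof -
  let ?m = "min (norm \<zeta>) (norm (h + \<zeta>))" and ?L = "(2 * pi) ^ CARD('n) * CARD('n)"
  have diff: "\<bar>norm \<zeta> - norm (h + \<zeta>)\<bar> \<le> norm h"
    using norm_triangle_ineq3[of \<zeta> "h + \<zeta>"] by simp
  then have "norm \<zeta> \<le> ?m + 1 / 2" using h by linarith
  then have "(norm \<zeta>)\<^sup>2 \<le> (?m + 1 / 2)\<^sup>2" by (intro power_mono) auto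
  also have "\<dots> \<le> 2 * ?m\<^sup>2 + 2"
    using sum_squares_ge_zero[of "?m - 1 / 2" 0] by (simp add: power2_eq_square algebra_simps)
  finally have e: "exp (- ?m\<^sup>2) \<le> exp 1 * gauss \<zeta>"
    unfolding gauss_def exp_add[symmetric] by (subst exp_le_cancel_iff) linarith
  have "\<bar>heat_symbol \<zeta> - heat_symbol (h + \<zeta>)\<bar> \<le> ?L * exp 1 * \<bar>norm \<zeta> - norm (h + \<zeta>)\<bar> * exp (- ?m\<^sup>2)"
    unfolding heat_symbol_def using d by (intro exp_power_lipschitz two_pi_power_ge) auto
  also have "\<dots> \<le> ?L * exp 1 * norm h * (exp 1 * gauss \<zeta>)"
    using diff e by (intro mult_mono) auto
  also have "\<dots> = ?L * exp 2 * norm h * gauss \<zeta>"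
    by (simp add: exp_add[of 1 1, simplified])
  finally show ?thesis .
qed

section \<open>Inversion formula, scaling and decay of the kernel\<close>

text \<open>Since \<open>a ^ CARD('n) = s\<close>, the dilated symbol is the Fourier transform of
  \<open>p s\<close>. It is integrable, so inversion applies, at every point because
  \<open>p s\<close> is continuous.\<close>

lemma fractional_heat_kernel_formula:
  fixes p :: "real \<Rightarrow> real^'n \<Rightarrow> real"
  assumes d: "CARD('n) \<ge> 2" and p: "fractional_heat_kernel p" and s: "s > 0"
  defines "a \<equiv> s powr (1 / CARD('n))"
  shows "complex_of_real (p s x) = (LINT \<zeta>|lborel. cis (2 * pi * (x \<bullet> \<zeta>)) * heat_symbol (a *\<^sub>R \<zeta>))"
proof -
  have a: "a > 0" "a ^ CARD('n) = s"
    using s by (auto simp: a_def powr_power)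
  have F: "fourier (p s) = (\<lambda>\<zeta>. complex_of_real (heat_symbol (a *\<^sub>R \<zeta>)))"
    using p s a by (auto simp: fractional_heat_kernel_def heat_symbol_def power_mult_distrib ac_simps)
  have "integrable lborel (\<lambda>\<zeta>::real^'n. heat_symbol (0 + a *\<^sub>R \<zeta>))"
    using a by (intro integrable_lborel_affine integrable_heat_symbol d) auto
  then show ?thesis
    using p s by (subst fourier_inversion) (auto simp: fractional_heat_kernel_def F)
qed

text \<open>Rescaling the frequency by \<open>1 / a\<close> in the inversion formula gives the
  Jacobian \<open>1 / s\<close> and moves the dilation to \<open>x\<close>.\<close>

lemma fractional_heat_kernel_scaling:
  fixes p :: "real \<Rightarrow> real^'n \<Rightarrow> real"
  assumes d: "CARD('n) \<ge> 2" and p: "fractional_heat_kernel p" and s: "s > 0"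
  shows "p s x = (1 / s) * p 1 ((1 / s powr (1 / CARD('n))) *\<^sub>R x)"
proof -
  define a where "a = s powr (1 / CARD('n))"
  have a: "a > 0" "a ^ CARD('n) = s"
    using s by (auto simp: a_def powr_power)
  have "complex_of_real (p s x) = (LINT \<zeta>|lborel. cis (2 * pi * (x \<bullet> \<zeta>)) * heat_symbol (a *\<^sub>R \<zeta>))"
    unfolding a_def by (rule fractional_heat_kernel_formula[OF d p s])
  also have "\<dots> = (1 / s) *\<^sub>R (LINT \<zeta>|lborel. cis (2 * pi * (((1 / a) *\<^sub>R x) \<bullet> \<zeta>)) * heat_symbol \<zeta>)"
    using a by (subst integral_lborel_affine[of _ "1 / a" 0]) (auto simp: power_divide)
  also have "(LINT \<zeta>|lborel. cis (2 * pi * (((1 / a) *\<^sub>R x) \<bullet> \<zeta>)) * heat_symbol \<zeta>) = complex_of_real (p 1 ((1 / a) *\<^sub>R x))"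
    by (subst fractional_heat_kernel_formula[OF d p]) simp_all
  finally have "complex_of_real (p s x) = complex_of_real ((1 / s) * p 1 ((1 / a) *\<^sub>R x))"
    by (simp only: scaleR_conv_of_real of_real_mult)
  then show ?thesis
    by (simp only: of_real_eq_iff a_def)
qed

text \<open>Boundedness covers \<open>norm z \<le> 1\<close>, and decay of order
  \<open>1 / norm z\<close> covers the rest. The weaker exponent \<open>1 / 2\<close> is recorded
  because the singularity \<open>1 / norm z\<close> is not integrable over a circle, the sphere in
  dimension two.\<close>

lemma fractional_heat_kernel_decay:
  fixes p :: "real \<Rightarrow> real^'n \<Rightarrow> real"
  assumes d: "CARD('n) \<ge> 2" and p: "fractional_heat_kernel p"
  obtains C where "\<And>z. \<bar>p 1 z\<bar> * sqrt (norm z) \<le> C"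
proof -
  have formula: "complex_of_real (p 1 z) = (LINT \<zeta>|lborel. cis (2 * pi * (z \<bullet> \<zeta>)) * heat_symbol \<zeta>)" for z
    by (subst fractional_heat_kernel_formula[OF d p]) simp_all
  note int = integrable_heat_symbol[OF d]
  define C0 where "C0 = (LINT \<zeta>|lborel. heat_symbol (\<zeta>::real^'n))"
  define L where "L = (2 * pi) ^ CARD('n) * CARD('n) * exp 2"
  define Z where "Z = (LINT v|lborel. gauss (v::real^'n))"
  have small: "\<bar>p 1 z\<bar> \<le> C0" for z
  proof -
    have "\<bar>p 1 z\<bar> = norm (LINT \<zeta>|lborel. cis (2 * pi * (z \<bullet> \<zeta>)) * heat_symbol \<zeta>)"
      unfolding formula[symmetric] by simp
    also have "\<dots> \<le> (LINT \<zeta>|lborel. norm (cis (2 * pi * (z \<bullet> \<zeta>)) * heat_symbol \<zeta>))"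
      by (rule integral_norm_bound)
    also have "\<dots> = C0" by (simp add: norm_mult C0_def abs_of_nonneg)
    finally show ?thesis .
  qed
  \<comment> \<open>Translating the frequency by \<open>h\<close> with \<open>z \<bullet> h = 1 / 2\<close> flips the sign of the character, so
    \<open>2 * p 1 z\<close> is an integral against \<open>heat_symbol \<zeta> - heat_symbol (h + \<zeta>)\<close>, which is \<open>O (norm h)\<close>.\<close>
  have large: "\<bar>p 1 z\<bar> * norm z \<le> L * Z" if z: "1 \<le> norm z" for z
  proof -
    define h where "h = (1 / (2 * (norm z)\<^sup>2)) *\<^sub>R z"
    have "z \<noteq> 0" using z by auto
    have nh: "norm h = 1 / (2 * norm z)" "norm h \<le> 1 / 2"
      using z \<open>z \<noteq> 0\<close> by (auto simp: h_def power2_eq_square field_simps)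
    have zh: "z \<bullet> h = 1 / 2"
      using \<open>z \<noteq> 0\<close> by (simp add: h_def power2_norm_eq_inner)
    have ci: "integrable lborel (\<lambda>\<zeta>. cis (2 * pi * (z \<bullet> \<zeta>)) * complex_of_real (g \<zeta>))"
      if "integrable lborel g" for g
      by (rule Bochner_Integration.integrable_bound[OF that])
         (use borel_measurable_integrable[OF that] in \<open>auto simp: norm_mult\<close>)
    have int_h: "integrable lborel (\<lambda>\<zeta>. heat_symbol (h + \<zeta>))"
      using integrable_lborel_affine[OF int, of 1 h] by simp
    have "cis (2 * pi * (z \<bullet> (h + \<zeta>))) = - cis (2 * pi * (z \<bullet> \<zeta>))" for \<zeta>
      by (simp add: inner_add_right zh distrib_left flip: cis_mult)
    then have "complex_of_real (p 1 z) = (LINT \<zeta>|lborel. - cis (2 * pi * (z \<bullet> \<zeta>)) * heat_symbol (h + \<zeta>))"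
      unfolding formula by (subst integral_lborel_affine[of _ 1 h]) auto
    then have "2 * complex_of_real (p 1 z)
        = (LINT \<zeta>|lborel. cis (2 * pi * (z \<bullet> \<zeta>)) * heat_symbol \<zeta>) - (LINT \<zeta>|lborel. cis (2 * pi * (z \<bullet> \<zeta>)) * heat_symbol (h + \<zeta>))"
      using formula[of z] by simp
    also have "\<dots> = (LINT \<zeta>|lborel. cis (2 * pi * (z \<bullet> \<zeta>)) * complex_of_real (heat_symbol \<zeta> - heat_symbol (h + \<zeta>)))"
      by (subst Bochner_Integration.integral_diff[symmetric]) (auto intro!: ci int int_h simp: right_diff_distrib)
    finally have eq: "2 * complex_of_real (p 1 z) = \<dots>" .
    have "2 * \<bar>p 1 z\<bar> = norm (2 * complex_of_real (p 1 z))"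
      by (simp add: norm_mult)
    also have "\<dots> \<le> (LINT \<zeta>|lborel. L * norm h * gauss (\<zeta>::real^'n))"
      unfolding eq
    proof (intro Bochner_Integration.integral_norm_bound_integral ci Bochner_Integration.integrable_diff int int_h
        integrable_mult_right integrable_gauss)
      fix \<zeta> :: "real^'n"
      show "norm (cis (2 * pi * (z \<bullet> \<zeta>)) * complex_of_real (heat_symbol \<zeta> - heat_symbol (h + \<zeta>))) \<le> L * norm h * gauss \<zeta>"
        unfolding norm_mult norm_cis norm_of_real L_def using heat_symbol_lipschitz[OF d nh(2), of \<zeta>] by simp
    qed
    also have "\<dots> = L * norm h * Z" by (simp add: Z_def)
    finally have "2 * \<bar>p 1 z\<bar> * norm z \<le> L * norm h * Z * norm z"
      by (rule mult_right_mono) simp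
    also have "\<dots> = L * Z / 2" using \<open>z \<noteq> 0\<close> by (simp add: nh)
    finally have "\<bar>p 1 z\<bar> * norm z \<le> L * Z / 4" by simp
    moreover have "0 \<le> L * Z" by (simp add: L_def Z_def)
    ultimately show ?thesis by simp
  qed
  have "\<bar>p 1 z\<bar> * sqrt (norm z) \<le> max C0 (L * Z)" for z
  proof (cases "norm z \<le> 1")
    case True
    then have "\<bar>p 1 z\<bar> * sqrt (norm z) \<le> \<bar>p 1 z\<bar> * 1" by (intro mult_left_mono) auto
    then show ?thesis using small[of z] by simp
  next
    case False
    then have "sqrt (norm z) \<le> norm z"
      by (intro real_le_lsqrt self_le_power) auto
    then have "\<bar>p 1 z\<bar> * sqrt (norm z) \<le> \<bar>p 1 z\<bar> * norm z" by (intro mult_left_mono) auto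
    then show ?thesis using large[of z] False by simp
  qed
  then show thesis by (rule that)
qed

subsection \<open>Averages over the sphere\<close>

lemma nn_integral_powr:
  fixes a c :: real
  assumes "a > -1" "c \<ge> 0"
  shows "(\<integral>\<^sup>+x. ennreal (x powr a) * indicator {0..c} x \<partial>lborel) = ennreal (c powr (a + 1) / (a + 1))"
  by (rule nn_integral_has_integral_lebesgue'[OF _ has_integral_powr_from_0]) (use assms in auto)

text \<open>The cutoff to \<open>{-1..1}\<close> fits the component of a point of the unit ball
  along a unit vector. The value at 0 is 0, by the convention for \<open>powr\<close>.\<close>

definition inv_sqrt :: "real \<Rightarrow> ennreal" where
  "inv_sqrt r = ennreal (\<bar>r\<bar> powr (- 1 / 2)) * indicator {-1..1} r"

lemma inv_sqrt_measurable [measurable]: "inv_sqrt \<in> borel_measurable borel"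
  unfolding inv_sqrt_def by measurable

text \<open>Translation invariance removes \<open>a\<close>, and each half-line contributes 2.
  Uniformity in \<open>a\<close> is what later makes the sphere bound uniform in
  \<open>x\<close>.\<close>

lemma nn_integral_inv_sqrt: "(\<integral>\<^sup>+r. inv_sqrt (a + r) \<partial>lborel) \<le> 4"
proof -
  let ?k = "\<lambda>r. ennreal (r powr (- 1 / 2)) * indicator {0..1} r"
  have k: "(\<integral>\<^sup>+r. ?k r \<partial>lborel) = 2"
    using nn_integral_powr[of "- 1 / 2" 1] by simp
  have "(\<integral>\<^sup>+r. inv_sqrt (a + r) \<partial>lborel) = (\<integral>\<^sup>+r. inv_sqrt r \<partial>lborel)"
    by (subst (2) nn_integral_lborel_affine[of _ 1 a]) auto
  also have "\<dots> \<le> (\<integral>\<^sup>+r. ?k r + ?k (- r) \<partial>lborel)"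
    by (intro nn_integral_mono) (auto simp: inv_sqrt_def indicator_def)
  also have "\<dots> = (\<integral>\<^sup>+r. ?k r \<partial>lborel) + (\<integral>\<^sup>+r. ?k (- r) \<partial>lborel)"
    by (intro nn_integral_add) auto
  also have "(\<integral>\<^sup>+r. ?k (- r) \<partial>lborel) = (\<integral>\<^sup>+r. ?k r \<partial>lborel)"
    by (subst (2) nn_integral_lborel_affine[of _ "-1" 0]) auto
  finally show ?thesis unfolding k by simp
qed

text \<open>By translation invariance the integral over the ball is unchanged by shifts along \<open>e\<close>;
  averaging over shifts in \<open>{-1..1}\<close> replaces Fubini in rotated coordinates.\<close>

lemma nn_integral_le_line_averages:
  fixes Q :: "'a::euclidean_space \<Rightarrow> ennreal"
  assumes [measurable]: "Q \<in> borel_measurable borel" and e: "norm e = 1"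
    and bound: "\<And>u. (\<integral>\<^sup>+t. Q (u + t *\<^sub>R e) * indicator (ball 0 1) (u + t *\<^sub>R e) \<partial>lborel) \<le> c"
  shows "2 * (\<integral>\<^sup>+u\<in>ball 0 1. Q u \<partial>lborel) \<le> c * emeasure lborel (ball (0::'a) 2)"
proof -
  let ?g = "\<lambda>u. Q u * indicator (ball 0 1) u"
  have [measurable]: "?g \<in> borel_measurable borel"
    by (intro borel_measurable_times_ennreal borel_measurable_indicator) auto
  \<comment> \<open>The factor 2 is the length of the interval of shifts.\<close>
  have "2 * (\<integral>\<^sup>+u. ?g u \<partial>lborel) = (\<integral>\<^sup>+t. (\<integral>\<^sup>+u. ?g u \<partial>lborel) * indicator {-1..1::real} t \<partial>lborel)"
    by (subst nn_integral_cmult_indicator) (auto simp: mult.commute)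
  also have "\<dots> = (\<integral>\<^sup>+t. (\<integral>\<^sup>+u. ?g (u + t *\<^sub>R e) * indicator {-1..1} t \<partial>lborel) \<partial>lborel)"
  proof (intro nn_integral_cong)
    fix t :: real
    have "(\<integral>\<^sup>+u. ?g u \<partial>lborel) = (\<integral>\<^sup>+u. ?g (u + t *\<^sub>R e) \<partial>lborel)"
      by (subst nn_integral_lborel_affine[of _ 1 "t *\<^sub>R e"]) (auto simp: add.commute)
    then show "(\<integral>\<^sup>+u. ?g u \<partial>lborel) * indicator {-1..1} t
        = (\<integral>\<^sup>+u. ?g (u + t *\<^sub>R e) * indicator {-1..1} t \<partial>lborel)"
      by (simp add: nn_integral_multc)
  qed
  also have "\<dots> = (\<integral>\<^sup>+u. (\<integral>\<^sup>+t. ?g (u + t *\<^sub>R e) * indicator {-1..1} t \<partial>lborel) \<partial>lborel)"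
    by (rule lborel_pair.Fubini') measurable
  also have "\<dots> \<le> (\<integral>\<^sup>+u. c * indicator (ball (0::'a) 2) u \<partial>lborel)"
  proof (intro nn_integral_mono)
    fix u :: 'a
    show "(\<integral>\<^sup>+t. ?g (u + t *\<^sub>R e) * indicator {-1..1} t \<partial>lborel) \<le> c * indicator (ball 0 2) u"
    proof (cases "u \<in> ball 0 2")
      case True
      have "(\<integral>\<^sup>+t. ?g (u + t *\<^sub>R e) * indicator {-1..1} t \<partial>lborel) \<le> (\<integral>\<^sup>+t. ?g (u + t *\<^sub>R e) \<partial>lborel)"
        by (intro nn_integral_mono) (simp add: indicator_def)
      also have "\<dots> \<le> c" by (rule bound)
      finally show ?thesis using True by simp
    next
      case False
      \<comment> \<open>A shift by at most 1 cannot carry a point outside the ball of radius 2 into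
        the unit ball.\<close>
      have "?g (u + t *\<^sub>R e) * indicator {-1..1} t = 0" for t
      proof -
        have "norm u \<le> norm (u + t *\<^sub>R e) + \<bar>t\<bar>"
          using norm_triangle_ineq4[of "u + t *\<^sub>R e" "t *\<^sub>R e"] e by simp
        then show ?thesis using False by (auto simp: indicator_def)
      qed
      then show ?thesis by (simp only: nn_integral_const mult_zero_left zero_le)
    qed
  qed
  also have "\<dots> = c * emeasure lborel (ball (0::'a) 2)"
    by (simp add: nn_integral_cmult_indicator)
  finally show ?thesis .
qed

text \<open>Orthogonality makes the component of \<open>x - sgn u\<close> along \<open>e\<close>
  independent of \<open>x\<close>, and normalizing a vector of norm at most 1 does not shrink its
  component.\<close>

lemma sgn_distance_ge:
  fixes x u e :: "'a::real_inner"
  assumes "norm e = 1" "x \<bullet> e = 0" "norm u \<le> 1"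
  shows "\<bar>u \<bullet> e\<bar> \<le> norm (x - sgn u)"
proof -
  have "\<bar>u \<bullet> e\<bar> = norm u * \<bar>sgn u \<bullet> e\<bar>"
    by (cases "u = 0") (simp_all add: sgn_div_norm abs_mult)
  also have "\<dots> \<le> \<bar>sgn u \<bullet> e\<bar>"
    using assms(3) by (intro mult_left_le_one_le) auto
  also have "\<dots> = \<bar>(x - sgn u) \<bullet> e\<bar>"
    using assms(2) by (simp add: inner_diff_left)
  also have "\<dots> \<le> norm (x - sgn u)"
    using Cauchy_Schwarz_ineq2[of "x - sgn u" e] assms(1) by simp
  finally show ?thesis .
qed

text \<open>Choosing \<open>e\<close> orthogonal to \<open>x\<close> bounds the integrand at
  \<open>u\<close> in the ball by a multiple of the inverse square root of the component of
  \<open>u\<close> along \<open>e\<close>. Its integrals over lines parallel to \<open>e\<close> are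
  at most \<open>4 * c\<close>, wherever \<open>x\<close> lies. Dimension at least two guarantees
  such an \<open>e\<close>.\<close>

lemma unif_sphere_nn_integral_le:
  fixes q :: "real^'n \<Rightarrow> real"
  assumes d: "CARD('n) \<ge> 2" and [measurable]: "q \<in> borel_measurable borel"
    and q: "\<And>z. \<bar>q z\<bar> * sqrt (norm z) \<le> c"
  shows "(\<integral>\<^sup>+y. \<bar>q (x - y)\<bar> \<partial>unif_sphere 0 1)
    \<le> ennreal (2 * measure lborel (ball (0::real^'n) 2) / measure lborel (ball (0::real^'n) 1) * c)"
proof -
  obtain e0 :: "real^'n" where "e0 \<noteq> 0" "orthogonal x e0"
    using orthogonal_to_vector_exists[of x] d by auto
  then obtain e :: "real^'n" where e: "norm e = 1" "x \<bullet> e = 0"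
    by (intro that[of "sgn e0"]) (auto simp: norm_sgn orthogonal_def sgn_div_norm)
  have c: "0 \<le> c"
    using order_trans[OF _ q[of 0]] by simp
  define B1 B2 where "B1 = measure lborel (ball (0::real^'n) 1)" and "B2 = measure lborel (ball (0::real^'n) 2)"
  have B: "emeasure lborel (ball (0::real^'n) 1) = ennreal B1" "emeasure lborel (ball (0::real^'n) 2) = ennreal B2" "0 \<le> B2"
    by (simp_all add: B1_def B2_def emeasure_eq_ennreal_measure
        emeasure_lborel_ball_finite[unfolded infinity_ennreal_def, THEN less_imp_neq])
  have B1: "B1 > 0"
    unfolding B1_def by (rule content_ball_pos) simp
  let ?Q = "\<lambda>u. ennreal \<bar>q (x - sgn u)\<bar>"
  \<comment> \<open>The hyperplane \<open>u \<bullet> e = 0\<close> is excluded because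
    \<open>inv_sqrt 0 = 0\<close> would make the bound false there in general; each line parallel to
    \<open>e\<close> meets it in one point, a null set.\<close>
  have Q: "?Q u * indicator (ball 0 1) u \<le> ennreal c * inv_sqrt (u \<bullet> e)" if "u \<bullet> e \<noteq> 0" for u
  proof (cases "u \<in> ball 0 1")
    case True
    have "\<bar>u \<bullet> e\<bar> \<le> norm u * norm e" by (rule Cauchy_Schwarz_ineq2)
    then have u1: "\<bar>u \<bullet> e\<bar> \<le> 1" using True e by simp
    have "\<bar>q (x - sgn u)\<bar> * sqrt \<bar>u \<bullet> e\<bar> \<le> \<bar>q (x - sgn u)\<bar> * sqrt (norm (x - sgn u))"
      using sgn_distance_ge[OF e, of u] True by (intro mult_left_mono) auto
    also have "\<dots> \<le> c" by (rule q)
    finally have "\<bar>q (x - sgn u)\<bar> \<le> c / sqrt \<bar>u \<bullet> e\<bar>"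
      using that by (simp add: pos_le_divide_eq)
    also have "\<dots> = c * \<bar>u \<bullet> e\<bar> powr (- 1 / 2)"
      using powr_minus_divide[of "\<bar>u \<bullet> e\<bar>" "1 / 2"] powr_half_sqrt[of "\<bar>u \<bullet> e\<bar>"] by simp
    finally show ?thesis
      using True u1 c by (simp add: inv_sqrt_def indicator_def abs_le_iff flip: ennreal_mult)
  qed simp
  have "2 * (\<integral>\<^sup>+u\<in>ball 0 1. ?Q u \<partial>lborel) \<le> (ennreal c * 4) * emeasure lborel (ball (0::real^'n) 2)"
  proof (rule nn_integral_le_line_averages[OF _ e(1)])
    fix u :: "real^'n"
    have "(\<integral>\<^sup>+t. ?Q (u + t *\<^sub>R e) * indicator (ball 0 1) (u + t *\<^sub>R e) \<partial>lborel)
        \<le> (\<integral>\<^sup>+t. ennreal c * inv_sqrt (u \<bullet> e + t) \<partial>lborel)"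
    proof (rule nn_integral_mono_AE)
      have eq: "(u + t *\<^sub>R e) \<bullet> e = u \<bullet> e + t" for t
        using e(1) by (simp add: inner_add_left norm_eq_1)
      show "AE t in lborel. ?Q (u + t *\<^sub>R e) * indicator (ball 0 1) (u + t *\<^sub>R e)
          \<le> ennreal c * inv_sqrt (u \<bullet> e + t)"
        using AE_lborel_singleton[of "- (u \<bullet> e)"]
      proof eventually_elim
        case (elim t)
        then have "u \<bullet> e + t \<noteq> 0" by linarith
        then show ?case using Q[of "u + t *\<^sub>R e", unfolded eq] by blast
      qed
    qed
    also have "\<dots> \<le> ennreal c * 4"
      using nn_integral_inv_sqrt[of "u \<bullet> e"] by (subst nn_integral_cmult) (auto intro: mult_left_mono)
    finally show "(\<integral>\<^sup>+t. ?Q (u + t *\<^sub>R e) * indicator (ball 0 1) (u + t *\<^sub>R e) \<partial>lborel) \<le> ennreal c * 4" .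
  qed simp
  also have "\<dots> = 2 * ennreal (2 * c * B2)"
    using B c by (simp add: ac_simps flip: ennreal_mult ennreal_numeral)
  finally have *: "(\<integral>\<^sup>+u\<in>ball 0 1. ?Q u \<partial>lborel) \<le> ennreal (2 * c * B2)"
    by (simp add: ennreal_mult_le_mult_iff)
  have "(\<integral>\<^sup>+y. \<bar>q (x - y)\<bar> \<partial>unif_sphere 0 1) = (\<integral>\<^sup>+u\<in>ball 0 1. ?Q u \<partial>lborel) / ennreal B1"
    unfolding unif_sphere_def using B B1
    by (subst nn_integral_distr) (auto simp: nn_integral_uniform_measure)
  also have "\<dots> \<le> ennreal (2 * c * B2) / ennreal B1"
    using * by (rule divide_right_mono_ennreal)
  also have "\<dots> = ennreal (2 * B2 / B1 * c)"
    using B1 B c by (simp add: divide_ennreal ac_simps)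
  finally show ?thesis unfolding B1_def B2_def .
qed

subsection \<open>The variance of the sphere average\<close>

text \<open>Scaling contributes \<open>1 / s\<close> from the prefactor and \<open>sqrt a\<close>
  from the weight, where \<open>a\<close> is the \<open>CARD('n)\<close>-th root of
  \<open>s\<close>; the exponent is that of \<open>sqrt a / s\<close>.\<close>

lemma fractional_heat_kernel_scaled_decay:
  fixes p :: "real \<Rightarrow> real^'n \<Rightarrow> real"
  assumes d: "CARD('n) \<ge> 2" and p: "fractional_heat_kernel p" and s: "s > 0"
    and C: "\<And>z. \<bar>p 1 z\<bar> * sqrt (norm z) \<le> C"
  shows "\<bar>p s z\<bar> * sqrt (norm z) \<le> C * s powr (1 / (2 * real CARD('n)) - 1)"
proof -
  define a where "a = s powr (1 / CARD('n))"
  have a: "a > 0" using s by (simp add: a_def)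
  have "sqrt a = s powr (1 / (2 * real CARD('n)))"
    using s by (simp add: a_def powr_powr mult.commute flip: powr_half_sqrt)
  then have sa: "sqrt a / s = s powr (1 / (2 * real CARD('n)) - 1)"
    using s by (simp add: powr_diff)
  have "\<bar>p s z\<bar> * sqrt (norm z) = (sqrt a / s) * (\<bar>p 1 ((1 / a) *\<^sub>R z)\<bar> * sqrt (norm ((1 / a) *\<^sub>R z)))"
    using a s by (simp add: fractional_heat_kernel_scaling[OF d p s] abs_mult real_sqrt_divide flip: a_def)
  also have "\<dots> \<le> (sqrt a / s) * C"
    using a s by (intro mult_left_mono C) auto
  finally show ?thesis by (simp add: sa mult.commute)
qed

text \<open>The Jacobian of \<open>x \<mapsto> y + a *\<^sub>R x\<close> is \<open>s\<close>, which
  cancels the prefactor in the scaling relation.\<close>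

lemma fractional_heat_kernel_L1_norm:
  fixes p :: "real \<Rightarrow> real^'n \<Rightarrow> real"
  assumes d: "CARD('n) \<ge> 2" and p: "fractional_heat_kernel p" and s: "s > 0"
  shows "(\<integral>\<^sup>+x. \<bar>p s (x - y)\<bar> \<partial>lborel) = (\<integral>\<^sup>+x. \<bar>p 1 x\<bar> \<partial>lborel)"
proof -
  define a where "a = s powr (1 / CARD('n))"
  have a: "a > 0" "a ^ CARD('n) = s"
    using s by (auto simp: a_def powr_power)
  have [measurable]: "p t \<in> borel_measurable borel" if "t > 0" for t
    using p that unfolding fractional_heat_kernel_def by (auto intro: borel_measurable_continuous_onI)
  have [measurable]: "p s \<in> borel_measurable borel" "p 1 \<in> borel_measurable borel"
    using s by auto
  have "(\<integral>\<^sup>+x. \<bar>p s (x - y)\<bar> \<partial>lborel) = ennreal s * (\<integral>\<^sup>+x. \<bar>p s (a *\<^sub>R x)\<bar> \<partial>lborel)"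
    using a by (subst nn_integral_lborel_affine[of _ a y]) auto
  also have "\<dots> = (\<integral>\<^sup>+x. ennreal s * \<bar>p s (a *\<^sub>R x)\<bar> \<partial>lborel)"
    by (rule nn_integral_cmult[symmetric]) measurable
  also have "\<dots> = (\<integral>\<^sup>+x. \<bar>p 1 x\<bar> \<partial>lborel)"
    using a s by (intro nn_integral_cong)
      (simp add: fractional_heat_kernel_scaling[OF d p s] abs_mult flip: a_def ennreal_mult)
  finally show ?thesis .
qed

text \<open>One factor of the square is bounded by \<open>D\<close> uniformly in \<open>x\<close>;
  the other is integrated over \<open>x\<close> first by Tonelli, and \<open>\<nu>\<close> has total
  mass 1.\<close>

lemma nn_integral_square_average_le:
  fixes q :: "real^'n \<Rightarrow> real"
  assumes \<nu>: "prob_space \<nu>" "sets \<nu> = sets borel" and [measurable]: "q \<in> borel_measurable borel"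
    and D: "\<And>x. (\<integral>\<^sup>+y. \<bar>q (x - y)\<bar> \<partial>\<nu>) \<le> ennreal D"
    and A: "\<And>y. (\<integral>\<^sup>+x. \<bar>q (x - y)\<bar> \<partial>lborel) \<le> A"
  shows "(\<integral>\<^sup>+x. ennreal ((LINT y|\<nu>. q (x - y))\<^sup>2) \<partial>lborel) \<le> ennreal D * A"
proof -
  interpret \<nu>: prob_space \<nu> by fact
  interpret pair_sigma_finite lborel \<nu> by standard
  have [measurable_cong]: "sets \<nu> = sets borel" by fact
  have sq: "ennreal ((LINT y|\<nu>. q (x - y))\<^sup>2) \<le> ennreal D * (\<integral>\<^sup>+y. \<bar>q (x - y)\<bar> \<partial>\<nu>)" for x
  proof -
    have "ennreal \<bar>LINT y|\<nu>. q (x - y)\<bar> \<le> (\<integral>\<^sup>+y. \<bar>q (x - y)\<bar> \<partial>\<nu>)"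
    \<comment> \<open>Where the average fails to be integrable, its integral is 0 by convention and
      the bound is trivial.\<close>
    proof (cases "integrable \<nu> (\<lambda>y. q (x - y))")
      case True
      then show ?thesis using integral_norm_bound_ennreal by fastforce
    qed (simp add: not_integrable_integral_eq)
    then have "ennreal \<bar>LINT y|\<nu>. q (x - y)\<bar> * ennreal \<bar>LINT y|\<nu>. q (x - y)\<bar>
        \<le> ennreal D * (\<integral>\<^sup>+y. \<bar>q (x - y)\<bar> \<partial>\<nu>)"
      using D[of x] by (intro mult_mono) auto
    then show ?thesis by (simp add: power2_eq_square flip: ennreal_mult)
  qed
  have "(\<integral>\<^sup>+x. ennreal ((LINT y|\<nu>. q (x - y))\<^sup>2) \<partial>lborel)
      \<le> (\<integral>\<^sup>+x. ennreal D * (\<integral>\<^sup>+y. \<bar>q (x - y)\<bar> \<partial>\<nu>) \<partial>lborel)"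
    by (intro nn_integral_mono sq)
  also have "\<dots> = ennreal D * (\<integral>\<^sup>+x. (\<integral>\<^sup>+y. \<bar>q (x - y)\<bar> \<partial>\<nu>) \<partial>lborel)"
    by (rule nn_integral_cmult) measurable
  also have "(\<integral>\<^sup>+x. (\<integral>\<^sup>+y. \<bar>q (x - y)\<bar> \<partial>\<nu>) \<partial>lborel) = (\<integral>\<^sup>+y. (\<integral>\<^sup>+x. \<bar>q (x - y)\<bar> \<partial>lborel) \<partial>\<nu>)"
    by (rule Fubini'[symmetric]) measurable
  also have "\<dots> \<le> (\<integral>\<^sup>+y. A \<partial>\<nu>)"
    by (intro nn_integral_mono A)
  also have "\<dots> = A" by (simp add: \<nu>.emeasure_space_1)
  finally show ?thesis by (simp add: mult_left_mono)
qed

section \<open>The integrand of the sphere average: measurability and squared norm\<close>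

text \<open>This is the function that \<open>h0_pairing\<close> hands to \<open>W\<close> for the
  unit sphere about the origin, without the constant prefactor.\<close>

definition sphere_integrand :: "(real \<Rightarrow> real^'n \<Rightarrow> real) \<Rightarrow> real \<Rightarrow> (real^'n) \<times> real \<Rightarrow> real" where
  "sphere_integrand p \<beta> = (\<lambda>(x, t). indicator {0<..\<beta>\<^sup>2} t * (LINT y|unif_sphere 0 1. p (t / 2) (x - y)))"

text \<open>The scaling relation is what gives measurability of the kernel jointly in space and time.\<close>

lemma sphere_integrand_measurable:
  fixes p :: "real \<Rightarrow> real^'n \<Rightarrow> real"
  assumes d: "CARD('n) \<ge> 2" and p: "fractional_heat_kernel p"
  shows "sphere_integrand p \<beta> \<in> borel_measurable borel"
proof -
  interpret prob_space "unif_sphere (0::real^'n) 1" by (rule prob_space_unif_sphere)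
  have [measurable]: "p 1 \<in> borel_measurable borel"
    using p unfolding fractional_heat_kernel_def by (auto intro: borel_measurable_continuous_onI)
  let ?q = "\<lambda>z y. (1 / (snd z / 2)) * p 1 ((1 / (snd z / 2) powr (1 / CARD('n))) *\<^sub>R (fst z - y))"
  have "(\<lambda>(z, y). ?q z y) \<in> borel_measurable ((borel \<Otimes>\<^sub>M borel) \<Otimes>\<^sub>M borel)"
    by measurable
  also have "borel_measurable ((borel \<Otimes>\<^sub>M borel) \<Otimes>\<^sub>M borel)
      = borel_measurable ((borel \<Otimes>\<^sub>M borel) \<Otimes>\<^sub>M unif_sphere (0::real^'n) 1)"
    by (intro measurable_cong_sets sets_pair_measure_cong refl) (simp add: unif_sphere_def)
  finally have "(\<lambda>z. LINT y|unif_sphere 0 1. ?q z y) \<in> borel_measurable (borel \<Otimes>\<^sub>M borel)"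
    by (rule borel_measurable_lebesgue_integral)
  then have m: "(\<lambda>z. indicator {0<..\<beta>\<^sup>2} (snd z) * (LINT y|unif_sphere 0 1. ?q z y)) \<in> borel_measurable (borel \<Otimes>\<^sub>M borel)"
    by (intro borel_measurable_times measurable_compose[OF measurable_snd borel_measurable_indicator]) auto
  have "sphere_integrand p \<beta> = (\<lambda>z. indicator {0<..\<beta>\<^sup>2} (snd z) * (LINT y|unif_sphere 0 1. ?q z y))"
  proof
    fix z :: "(real^'n) \<times> real"
    show "sphere_integrand p \<beta> z = indicator {0<..\<beta>\<^sup>2} (snd z) * (LINT y|unif_sphere 0 1. ?q z y)"
    \<comment> \<open>For nonpositive times \<open>p\<close> is unspecified, but the indicator makes
      both sides 0.\<close>
    proof (cases "snd z > 0")
      case True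
      then have "p (snd z / 2) (fst z - y) = ?q z y" for y
        by (intro fractional_heat_kernel_scaling[OF d p]) simp
      then show ?thesis by (simp only: sphere_integrand_def case_prod_beta)
    qed (simp add: sphere_integrand_def case_prod_beta)
  qed
  also note m
  finally show ?thesis by (simp add: borel_prod)
qed

text \<open>On each time slice the sphere bound and the constant \<open>L1\<close> norm give a
  multiple of \<open>t powr \<gamma>\<close>; integrating over \<open>t\<close> up to
  \<open>\<beta>\<^sup>2\<close> raises the exponent to \<open>\<gamma> + 1\<close>.\<close>

lemma sphere_integrand_L2_bound:
  fixes p :: "real \<Rightarrow> real^'n \<Rightarrow> real"
  assumes d: "CARD('n) \<ge> 2" and p: "fractional_heat_kernel p"
  obtains B where "0 \<le> B"
    "\<And>\<beta>. (\<integral>\<^sup>+z. ennreal ((sphere_integrand p \<beta> z)\<^sup>2) \<partial>spacetime) \<le> ennreal (B * (\<beta>\<^sup>2) powr (1 / (2 * real CARD('n))))"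
proof -
  obtain C where C: "\<And>z. \<bar>p 1 z\<bar> * sqrt (norm z) \<le> C"
    using fractional_heat_kernel_decay[OF d p] by blast
  have C0: "0 \<le> C" using order_trans[OF _ C[of 0]] by simp
  define V where "V = 2 * measure lborel (ball (0::real^'n) 2) / measure lborel (ball (0::real^'n) 1)"
  have V0: "0 \<le> V" by (simp add: V_def)
  define A where "A = (LINT x|lborel. \<bar>p 1 x\<bar>)"
  have "integrable lborel (p 1)" using p by (simp add: fractional_heat_kernel_def)
  then have A: "(\<integral>\<^sup>+x. \<bar>p 1 x\<bar> \<partial>lborel) = ennreal A"
    unfolding A_def by (intro nn_integral_eq_integral) auto
  have A0: "0 \<le> A" by (simp add: A_def)
  define \<gamma> where "\<gamma> = 1 / (2 * real CARD('n)) - 1"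
  \<comment> \<open>This is what makes the power of \<open>t\<close> integrable at 0.\<close>
  have \<gamma>: "\<gamma> > -1" by (simp add: \<gamma>_def)
  \<comment> \<open>The power of \<open>1 / 2\<close> comes from evaluating the kernel at time
    \<open>t / 2\<close>.\<close>
  define D where "D = V * C * (1 / 2) powr \<gamma>"
  have D0: "0 \<le> D" using V0 C0 by (simp add: D_def)
  have [measurable]: "sphere_integrand p \<beta> \<in> borel_measurable (lborel \<Otimes>\<^sub>M lborel)" for \<beta>
    using sphere_integrand_measurable[OF d p, of \<beta>] by (simp add: lborel_prod)
  have slice: "(\<integral>\<^sup>+x. ennreal ((sphere_integrand p \<beta> (x, t))\<^sup>2) \<partial>lborel)
      \<le> ennreal (D * A) * (ennreal (t powr \<gamma>) * indicator {0..\<beta>\<^sup>2} t)" for \<beta> t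
  proof (cases "t \<in> {0<..\<beta>\<^sup>2}")
    case True
    then have t: "t / 2 > 0" by simp
    have m: "p (t / 2) \<in> borel_measurable borel"
      using p t unfolding fractional_heat_kernel_def by (auto intro: borel_measurable_continuous_onI)
    have "(\<integral>\<^sup>+y. \<bar>p (t / 2) (x - y)\<bar> \<partial>unif_sphere 0 1) \<le> ennreal (V * (C * (t / 2) powr \<gamma>))" for x
      unfolding V_def \<gamma>_def
      by (rule unif_sphere_nn_integral_le[OF d m fractional_heat_kernel_scaled_decay[OF d p t C]])
    also have "V * (C * (t / 2) powr \<gamma>) = D * t powr \<gamma>"
      using True by (simp add: D_def powr_divide)
    finally have "(\<integral>\<^sup>+x. ennreal ((LINT y|unif_sphere 0 1. p (t / 2) (x - y))\<^sup>2) \<partial>lborel) \<le> ennreal (D * t powr \<gamma>) * ennreal A"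
      by (intro nn_integral_square_average_le prob_space_unif_sphere m)
         (auto simp: unif_sphere_def fractional_heat_kernel_L1_norm[OF d p t] A)
    then show ?thesis
      using True A0 D0 by (simp add: sphere_integrand_def ac_simps flip: ennreal_mult)
  qed (simp add: sphere_integrand_def)
  show thesis
  proof (rule that[of "D * A / (\<gamma> + 1)"])
    show "0 \<le> D * A / (\<gamma> + 1)" using D0 A0 \<gamma> by simp
    fix \<beta> :: real
    have "(\<integral>\<^sup>+z. ennreal ((sphere_integrand p \<beta> z)\<^sup>2) \<partial>spacetime)
        \<le> (\<integral>\<^sup>+z. ennreal ((sphere_integrand p \<beta> z)\<^sup>2) \<partial>(lborel \<Otimes>\<^sub>M lborel))"
      unfolding spacetime_def
      by (subst nn_integral_restrict_space) (auto simp: lborel_prod indicator_def intro!: nn_integral_mono borel_closed closed_Times)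
    also have "\<dots> = (\<integral>\<^sup>+t. (\<integral>\<^sup>+x. ennreal ((sphere_integrand p \<beta> (x, t))\<^sup>2) \<partial>lborel) \<partial>lborel)"
      by (rule lborel_pair.nn_integral_snd[symmetric]) measurable
    also have "\<dots> \<le> (\<integral>\<^sup>+t. ennreal (D * A) * (ennreal (t powr \<gamma>) * indicator {0..\<beta>\<^sup>2} t) \<partial>lborel)"
      by (intro nn_integral_mono slice)
    also have "\<dots> = ennreal (D * A) * ennreal ((\<beta>\<^sup>2) powr (\<gamma> + 1) / (\<gamma> + 1))"
      using \<gamma> by (subst nn_integral_cmult) (auto simp: nn_integral_powr)
    also have "\<dots> = ennreal (D * A / (\<gamma> + 1) * (\<beta>\<^sup>2) powr (1 / (2 * real CARD('n))))"
      using D0 A0 \<gamma> by (simp add: \<gamma>_def flip: ennreal_mult)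
    finally show "(\<integral>\<^sup>+z. ennreal ((sphere_integrand p \<beta> z)\<^sup>2) \<partial>spacetime) \<le> \<dots>" .
  qed
qed

section \<open>Chebyshev's inequality and the limit\<close>

lemma centered_gaussian_tail:
  assumes "prob_space M" and X: "centered_gaussian M X v" and v: "0 \<le> v" and \<epsilon>: "0 < \<epsilon>"
  shows "measure M {\<omega> \<in> space M. \<bar>X \<omega>\<bar> > \<epsilon>} \<le> v / \<epsilon>\<^sup>2"
proof -
  interpret prob_space M by fact
  have [measurable]: "X \<in> borel_measurable M" using X by (simp add: centered_gaussian_def)
  show ?thesis
  proof (cases "v = 0")
    case True
    then have "AE \<omega> in M. X \<omega> = 0" using X by (simp add: centered_gaussian_def)
    then have "measure M {\<omega> \<in> space M. \<bar>X \<omega>\<bar> > \<epsilon>} = 0"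
      using \<epsilon> by (subst prob_Collect_eq_0) (auto elim!: eventually_mono)
    then show ?thesis using v by simp
  next
    case False
    with v X have s: "0 < sqrt v" and D: "distributed M lborel X (normal_density 0 (sqrt v))"
      by (auto simp: centered_gaussian_def)
    have E: "expectation X = 0" using normal_distributed_expectation[OF s D] .
    have V: "variance X = v" using normal_distributed_variance[OF s D] v by simp
    \<comment> \<open>If the square were not integrable, its integral would be 0 by convention,
      contradicting the variance \<open>v\<close>, which is nonzero here.\<close>
    have int: "integrable M (\<lambda>\<omega>. (X \<omega>)\<^sup>2)"
      using V E False not_integrable_integral_eq by fastforce
    have "measure M {\<omega> \<in> space M. \<bar>X \<omega>\<bar> > \<epsilon>} \<le> measure M {\<omega> \<in> space M. \<bar>X \<omega> - expectation X\<bar> \<ge> \<epsilon>}"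
      by (intro finite_measure_mono) (auto simp: E)
    also have "\<dots> \<le> v / \<epsilon>\<^sup>2"
      using Chebyshev_inequality[OF _ int \<epsilon>] V by simp
    finally show ?thesis .
  qed
qed

theorem lemma2p5:
  fixes M :: "'w measure"
    and W :: "((real^'n) \<times> real \<Rightarrow> real) \<Rightarrow> 'w \<Rightarrow> real"
    and p :: "real \<Rightarrow> real^'n \<Rightarrow> real"
  assumes "CARD('n) \<ge> 2"
    and "fractional_heat_kernel p"
    and "white_noise M W"
  shows "tendsto_in_prob M (\<lambda>\<beta>. h0_sphere_avg W p \<beta> 1 0) 0 (at_right 0)"
proof -
  note d = assms(1) and p = assms(2)
  interpret prob_space M using assms(3) by (simp add: white_noise_def)
  obtain B where B: "0 \<le> B"
    "\<And>\<beta>. (\<integral>\<^sup>+z. ennreal ((sphere_integrand p \<beta> z)\<^sup>2) \<partial>spacetime) \<le> ennreal (B * (\<beta>\<^sup>2) powr (1 / (2 * real CARD('n))))"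
    using sphere_integrand_L2_bound[OF d p] by blast
  define c where "c = sqrt (c_const CARD('n))"
  have c: "c > 0" using d by (simp add: c_def c_const_def Gamma_real_pos)
  define v where "v \<beta> = (LINT z|spacetime. (sphere_integrand p \<beta> z)\<^sup>2)" for \<beta>
  define b where "b \<beta> = B * (\<beta>\<^sup>2) powr (1 / (2 * real CARD('n)))" for \<beta> :: real
  have h0: "h0_sphere_avg W p \<beta> 1 0 = (\<lambda>\<omega>. c * W (sphere_integrand p \<beta>) \<omega>)" for \<beta>
    by (simp add: h0_sphere_avg_def h0_pairing_def sphere_integrand_def c_def fun_eq_iff)
  have v_le: "v \<beta> \<le> b \<beta>" for \<beta>
    unfolding v_def b_def by (rule integral_real_bounded) (use B in auto)
  have v0: "0 \<le> v \<beta>" for \<beta> by (simp add: v_def)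
  have gaussian: "centered_gaussian M (W (sphere_integrand p \<beta>)) (v \<beta>)" for \<beta>
  proof -
    have [measurable]: "sphere_integrand p \<beta> \<in> borel_measurable spacetime"
      unfolding spacetime_def by (intro measurable_restrict_space1) (simp add: sphere_integrand_measurable[OF d p])
    \<comment> \<open>Finiteness of the squared norm gives membership in \<open>L2\<close>, the
      domain on which \<open>white_noise\<close> determines the law of \<open>W\<close>.\<close>
    have "sphere_integrand p \<beta> \<in> L2 spacetime"
      unfolding L2_def using order_le_less_trans[OF B(2)[of \<beta>] ennreal_less_top]
      by (auto intro!: integrableI_bounded)
    then show ?thesis using assms(3) by (simp add: white_noise_def v_def)
  qed
  \<comment> \<open>The exponent \<open>1 / (2 * real CARD('n))\<close> is a positive constant, so
    the power vanishes along with \<open>\<beta>\<^sup>2\<close>.\<close>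
  have b_lim: "(b \<longlongrightarrow> 0) (at_right 0)"
    unfolding b_def
    by (rule tendsto_mult_right_zero, rule tendsto_zero_powrI[OF _ tendsto_const])
       (auto intro!: tendsto_eq_intros)
  show ?thesis
    unfolding tendsto_in_prob_def h0
  proof (intro conjI allI impI always_eventually)
    show "(\<lambda>\<omega>. c * W (sphere_integrand p \<beta>) \<omega>) \<in> borel_measurable M" for \<beta>
      using gaussian[of \<beta>] by (auto simp: centered_gaussian_def)
    fix \<epsilon> :: real assume \<epsilon>: "\<epsilon> > 0"
    \<comment> \<open>The positive prefactor \<open>c\<close> is moved into the threshold, so that
      the tail bound applies to \<open>W\<close> itself.\<close>
    have "{\<omega> \<in> space M. \<bar>c * W (sphere_integrand p \<beta>) \<omega> - 0\<bar> > \<epsilon>}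
        = {\<omega> \<in> space M. \<bar>W (sphere_integrand p \<beta>) \<omega>\<bar> > \<epsilon> / c}" for \<beta>
      using c by (auto simp: abs_mult field_simps)
    then have est: "measure M {\<omega> \<in> space M. \<bar>c * W (sphere_integrand p \<beta>) \<omega> - 0\<bar> > \<epsilon>} \<le> b \<beta> / (\<epsilon> / c)\<^sup>2" for \<beta>
      using centered_gaussian_tail[OF prob_space_axioms gaussian v0, of "\<epsilon> / c" \<beta>] c \<epsilon>
        divide_right_mono[OF v_le, of "(\<epsilon> / c)\<^sup>2" \<beta>] by simp
    have "((\<lambda>\<beta>. b \<beta> / (\<epsilon> / c)\<^sup>2) \<longlongrightarrow> 0) (at_right 0)"
      using b_lim by (rule tendsto_divide_zero)
    then show "((\<lambda>\<beta>. measure M {\<omega> \<in> space M. \<bar>c * W (sphere_integrand p \<beta>) \<omega> - 0\<bar> > \<epsilon>}) \<longlongrightarrow> 0) (at_right 0)"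
      by (rule Lim_null_comparison[rotated]) (use est in auto)
  qed
qed

end
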